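(* Let $f=f_1+f_2$ on $\mathbb{R}^m$, where $f_1:\mathbb{R}^m\to\mathbb{R}\cup\{+\infty\}$ is a proper, closed and convex function and $f_2:\mathbb{R}^m\to\mathbb{R}$ is convex with $L_{f_2}$-Lipschitz continuous gradient. Let $A\in\mathbb{R}^{p\times m}$, $b\in\mathbb{R}^p$, and suppose the set $\Omega$ of saddle points of $\mathcal{L}(x,\lambda)=f(x)+\langle\lambda,Ax-b\rangle$ is nonempty. Let $\{x_k\}_{k\ge1}$ be generated by Algorithm 3 (described in the context) with parameters $\alpha,\gamma>0$, and let $(x^*,\lambda^* )\in\Omega$. Assume $\alpha\le\frac{1}{L_{f_2}}$ and that $\{t_k\}_{k\ge1}\subseteq[1,+\infty)$ is a nondecreasing sequence satisfying $t_{k+1}^2\le t_k^2+t_{k+1}$ for all $k\ge1$. Then for all $k\ge1$: $$\|Ax_k-b\|\le\frac{C_3}{t_k^2},\qquad |f(x_k)-f(x^* )|\le\frac{\mathcal{E}_1+C_3\|\lambda^*\|}{t_k^2},$$ where $$\mathcal{E}_1=t_1^2\big(f(x_1)-f(x^* )+\langle\lambda^*,Ax_1-b\rangle\big)+\frac{1}{2\alpha}\|x_1-x^*\|^2+\frac{1}{2\gamma}\|\lambda_1-\lambda^*\|^2,$$ $$C_3=3t_1^2\|Ax_1-b\|+\frac{2\|\lambda_1-\lambda^*\|+2\sqrt{2\gamma\mathcal{E}_1}}{\gamma}.$$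
   Context: Norms are Euclidean. $dom(F)=\{x: F(x)<+\infty\}$; $F$ is proper if $dom(F)\ne\emptyset$; $F$ is closed if $F(x)\le\liminf_{y\to x}F(y)$ for all $x$ and $dom(F)$ is closed. $1/0$ is read as $+\infty$ in step-size bounds. A saddle point is a pair $(x^*,\lambda^* )$ with $\mathcal{L}(x^*,\lambda)\le\mathcal{L}(x^*,\lambda^* )\le\mathcal{L}(x,\lambda^* )$ for all $(x,\lambda)$. Algorithm 3 (for $\min f(x)$ s.t. $Ax=b$). Initialize $x_1=x_0\in dom(f)$, $\lambda_1\in\mathbb{R}^p$. For $k=1,2,\dots$: - $\bar x_k=x_k+\frac{t_k-1}{t_{k+1}}(x_k-x_{k-1})$; - $x_{k+1}=\arg\min_x\big(f_1(x)+\langle A^T\lambda_k+\nabla f_2(\bar x_k),x\rangle+\frac{\gamma t_{k+1}^2}{2}\|A(x-x_k)+\frac{1}{t_{k+1}}(Ax_k-b)\|^2+\frac{1}{2\alpha}\|x-\bar x_k\|^2\big)$; - $u_{k+1}=x_{k+1}+(t_{k+1}-1)(x_{k+1}-x_k)$; - $\lambda_{k+1}=\lambda_k+\gamma t_{k+1}(Au_{k+1}-b)$. *)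

theory Defs
  imports "HOL-Analysis.Analysis"
begin

text \<open>
  Functions with values in \<open>\<real> \<union> {+\<infinity>}\<close> are modelled as \<^typ>\<open>ereal\<close>-valued functions;
  the absence of the value \<open>-\<infinity>\<close> is always required separately.
\<close>

definition edom :: "('a \<Rightarrow> ereal) \<Rightarrow> 'a set" where
  "edom F = {x. F x < \<infinity>}"

definition eproper :: "('a \<Rightarrow> ereal) \<Rightarrow> bool" where
  "eproper F \<longleftrightarrow> edom F \<noteq> {}"

definition eclosed :: "('a::topological_space \<Rightarrow> ereal) \<Rightarrow> bool" where
  "eclosed F \<longleftrightarrow> (\<forall>x. F x \<le> Liminf (at x) F) \<and> closed (edom F)"

text \<open>
  For functions without the value \<open>-\<infinity>\<close> the right-hand side is unambiguous; the boundary
  weights cause no problem because \<open>0 * \<infinity> = 0\<close> in \<^typ>\<open>ereal\<close>.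
\<close>

definition econvex :: "('a::real_vector \<Rightarrow> ereal) \<Rightarrow> bool" where
  "econvex F \<longleftrightarrow> (\<forall>x y u v. 0 \<le> u \<and> 0 \<le> v \<and> u + v = 1 \<longrightarrow>
     F (u *\<^sub>R x + v *\<^sub>R y) \<le> ereal u * F x + ereal v * F y)"

definition lagrangian ::
  "(real^'m \<Rightarrow> ereal) \<Rightarrow> real^'m^'p \<Rightarrow> real^'p \<Rightarrow> real^'m \<Rightarrow> real^'p \<Rightarrow> ereal" where
  "lagrangian f A b x lam = f x + ereal (lam \<bullet> (A *v x - b))"

definition saddle_points ::
  "(real^'m \<Rightarrow> ereal) \<Rightarrow> real^'m^'p \<Rightarrow> real^'p \<Rightarrow> ((real^'m) \<times> (real^'p)) set" where
  "saddle_points f A b = {(xs, ls). \<forall>x lam.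
     lagrangian f A b xs lam \<le> lagrangian f A b xs ls \<and>
     lagrangian f A b xs ls \<le> lagrangian f A b x ls}"

text \<open>
  The function minimised in the primal step, as a function of \<open>z\<close>. The arguments \<open>g\<close>, \<open>s\<close>,
  \<open>y\<close>, \<open>xbar\<close> and \<open>lam\<close> stand for \<open>\<nabla>f\<^sub>2(xbar\<^sub>k)\<close>, \<open>t\<^sub>k\<^sub>+\<^sub>1\<close>, \<open>x\<^sub>k\<close>, \<open>xbar\<^sub>k\<close> and \<open>\<lambda>\<^sub>k\<close>.
\<close>

definition primal_objective ::
  "(real^'m \<Rightarrow> ereal) \<Rightarrow> real^'m \<Rightarrow> real^'m^'p \<Rightarrow> real^'p \<Rightarrow> real \<Rightarrow> real \<Rightarrow> real \<Rightarrow>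
   real^'m \<Rightarrow> real^'m \<Rightarrow> real^'p \<Rightarrow> real^'m \<Rightarrow> ereal" where
  "primal_objective f1 g A b \<alpha> \<gamma> s y xbar lam z =
     f1 z + ereal ((transpose A *v lam + g) \<bullet> z
       + \<gamma> * s\<^sup>2 / 2 * (norm (A *v (z - y) + (1 / s) *\<^sub>R (A *v y - b)))\<^sup>2
       + 1 / (2 * \<alpha>) * (norm (z - xbar))\<^sup>2)"

text \<open>
  \<open>gf2\<close> is the gradient of the smooth part. Entries with index \<open>0\<close> other than \<open>x 0\<close>,
  and \<open>u 1\<close>, are irrelevant. As \<open>f2\<close> is finite, \<open>edom f1\<close> is the domain of \<open>f1 + f2\<close>.
\<close>

definition accelerated_alm_iterates ::
  "(real^'m \<Rightarrow> ereal) \<Rightarrow> (real^'m \<Rightarrow> real^'m) \<Rightarrow> real^'m^'p \<Rightarrow> real^'p \<Rightarrow> real \<Rightarrow> real \<Rightarrow>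
   (nat \<Rightarrow> real) \<Rightarrow> (nat \<Rightarrow> real^'m) \<Rightarrow> (nat \<Rightarrow> real^'m) \<Rightarrow> (nat \<Rightarrow> real^'m) \<Rightarrow>
   (nat \<Rightarrow> real^'p) \<Rightarrow> bool" where
  "accelerated_alm_iterates f1 gf2 A b \<alpha> \<gamma> t x xbar u lam \<longleftrightarrow>
     x 1 = x 0 \<and> x 0 \<in> edom f1 \<and>
     (\<forall>k\<ge>1.
        xbar k = x k + ((t k - 1) / t (k + 1)) *\<^sub>R (x k - x (k - 1)) \<and>
        is_arg_min (primal_objective f1 (gf2 (xbar k)) A b \<alpha> \<gamma> (t (k + 1)) (x k) (xbar k) (lam k))
          (\<lambda>_. True) (x (k + 1)) \<and>
        u (k + 1) = x (k + 1) + (t (k + 1) - 1) *\<^sub>R (x (k + 1) - x k) \<and>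
        lam (k + 1) = lam k + (\<gamma> * t (k + 1)) *\<^sub>R (A *v u (k + 1) - b))"

text \<open>
  \<^const>\<open>real_of_ereal\<close> loses no information below: it is applied at the initial point and at
  the primal part of a saddle point, where a proper \<open>f\<close> is finite.
\<close>

definition initial_energy ::
  "(real^'m \<Rightarrow> ereal) \<Rightarrow> real^'m^'p \<Rightarrow> real^'p \<Rightarrow> real \<Rightarrow> real \<Rightarrow> real \<Rightarrow>
   real^'m \<Rightarrow> real^'p \<Rightarrow> real^'m \<Rightarrow> real^'p \<Rightarrow> real" where
  "initial_energy f A b \<alpha> \<gamma> t1 x1 lam1 xs ls =
     t1\<^sup>2 * (real_of_ereal (f x1) - real_of_ereal (f xs) + ls \<bullet> (A *v x1 - b))
     + 1 / (2 * \<alpha>) * (norm (x1 - xs))\<^sup>2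
     + 1 / (2 * \<gamma>) * (norm (lam1 - ls))\<^sup>2"

definition feasibility_const ::
  "(real^'m \<Rightarrow> ereal) \<Rightarrow> real^'m^'p \<Rightarrow> real^'p \<Rightarrow> real \<Rightarrow> real \<Rightarrow> real \<Rightarrow>
   real^'m \<Rightarrow> real^'p \<Rightarrow> real^'m \<Rightarrow> real^'p \<Rightarrow> real" where
  "feasibility_const f A b \<alpha> \<gamma> t1 x1 lam1 xs ls =
     3 * t1\<^sup>2 * norm (A *v x1 - b)
     + (2 * norm (lam1 - ls) + 2 * sqrt (2 * \<gamma> * initial_energy f A b \<alpha> \<gamma> t1 x1 lam1 xs ls)) / \<gamma>"

end

theory Submission imports Defs begin

text \<open>
  The primal step yields, at \<open>x\<^sub>k\<^sub>+\<^sub>1\<close>, a subgradient inequality in which the updated multiplier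
  \<open>\<lambda>\<^sub>k\<^sub>+\<^sub>1\<close> appears, because the gradient of the quadratic penalty is exactly
  \<open>A\<^sup>T(\<lambda>\<^sub>k\<^sub>+\<^sub>1 - \<lambda>\<^sub>k)\<close>. Taken at \<open>x\<^sub>k\<close> with weight \<open>t\<^sub>k\<^sub>+\<^sub>1\<^sup>2 - t\<^sub>k\<^sub>+\<^sub>1\<close> and at \<open>x\<^sup>*\<close> with weight
  \<open>t\<^sub>k\<^sub>+\<^sub>1\<close>, it shows that the energy
  \<open>t\<^sub>k\<^sup>2 (f x\<^sub>k - f x\<^sup>* + \<langle>\<lambda>\<^sup>*, A x\<^sub>k - b\<rangle>) + \<parallel>u\<^sub>k - x\<^sup>*\<parallel>\<^sup>2/(2\<alpha>) + \<parallel>\<lambda>\<^sub>k - \<lambda>\<^sup>*\<parallel>\<^sup>2/(2\<gamma>)\<close> does not increase.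
  Hence the multipliers are bounded. The multiplier update is a recursion for
  \<open>t\<^sub>k\<^sup>2 (A x\<^sub>k - b)\<close> with contraction factors in \<open>[0,1]\<close>, so this sequence is bounded too.
\<close>

section \<open>Inequalities for smooth and for convex functions, obtained by restriction to
  lines\<close>

lemma GDERIV_along_line:
  fixes f :: "'a::real_inner \<Rightarrow> real"
  assumes "GDERIV f (x + v *\<^sub>R d) :> g"
  shows "((\<lambda>v. f (x + v *\<^sub>R d)) has_real_derivative (g \<bullet> d)) (at v)"
proof -
  have "((\<lambda>v. x + v *\<^sub>R d) has_derivative (\<lambda>h. h *\<^sub>R d)) (at v)"
    by (auto intro!: derivative_eq_intros)
  from has_derivative_compose[OF this assms[unfolded gderiv_def]]
  show ?thesis
    by (simp add: has_field_derivative_def inner_commute mult_commute_abs)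
qed

lemma convex_on_gradient_inequality:
  fixes f :: "'a::real_inner \<Rightarrow> real"
  assumes convex: "convex_on UNIV f" and grad: "GDERIV f x :> g"
  shows "f x + g \<bullet> (y - x) \<le> f y"
proof -
  define \<phi> where "\<phi> v = f (x + v *\<^sub>R (y - x))" for v :: real
  have "convex_on UNIV \<phi>"
  proof (rule convex_onI)
    fix v a c :: real assume "0 < v" "v < 1"
    have eq: "x + ((1 - v) * a + v * c) *\<^sub>R (y - x)
        = (1 - v) *\<^sub>R (x + a *\<^sub>R (y - x)) + v *\<^sub>R (x + c *\<^sub>R (y - x))"
      by (simp add: algebra_simps)
    show "\<phi> ((1 - v) *\<^sub>R a + v *\<^sub>R c) \<le> (1 - v) * \<phi> a + v * \<phi> c"
      unfolding \<phi>_def real_scaleR_def eq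
      using \<open>0 < v\<close> \<open>v < 1\<close> by (intro convex_onD[OF convex]) auto
  qed simp
  moreover have "(\<phi> has_real_derivative (g \<bullet> (y - x))) (at 0)"
    unfolding \<phi>_def by (rule GDERIV_along_line) (use grad in simp)
  ultimately have "\<phi> 1 - \<phi> 0 \<ge> g \<bullet> (y - x) * (1 - 0)"
    by (intro convex_on_imp_above_tangent[where A = UNIV]) auto
  then show ?thesis by (simp add: \<phi>_def)
qed

lemma descent_lemma:
  fixes f :: "'a::real_inner \<Rightarrow> real"
  assumes grad: "\<And>z. GDERIV f z :> g z" and lip: "L-lipschitz_on UNIV g"
  shows "f y \<le> f x + g x \<bullet> (y - x) + L / 2 * (norm (y - x))\<^sup>2"
proof -
  define d where "d = y - x"
  define \<psi> where "\<psi> v = f (x + v *\<^sub>R d) - v * (g x \<bullet> d) - L / 2 * v\<^sup>2 * (norm d)\<^sup>2" for v :: real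
  have deriv: "(\<psi> has_real_derivative
      (g (x + v *\<^sub>R d) \<bullet> d - g x \<bullet> d - L * v * (norm d)\<^sup>2)) (at v)" for v
    unfolding \<psi>_def
    by (auto intro!: derivative_eq_intros GDERIV_along_line[OF grad])
  have "\<psi> 1 \<le> \<psi> 0"
  proof (rule DERIV_nonpos_imp_nonincreasing[of 0 1 \<psi>])
    fix v :: real assume "0 \<le> v" "v \<le> 1"
    have "(g (x + v *\<^sub>R d) - g x) \<bullet> d \<le> norm (g (x + v *\<^sub>R d) - g x) * norm d"
      by (rule norm_cauchy_schwarz)
    also have "\<dots> \<le> (L * norm (v *\<^sub>R d)) * norm d"
      using lipschitz_onD[OF lip, of "x + v *\<^sub>R d" x]
      by (intro mult_right_mono) (auto simp: dist_norm)
    also have "\<dots> = L * v * (norm d)\<^sup>2"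
      using \<open>0 \<le> v\<close> by (simp add: power2_eq_square)
    finally have "g (x + v *\<^sub>R d) \<bullet> d - g x \<bullet> d - L * v * (norm d)\<^sup>2 \<le> 0"
      by (simp add: inner_diff_left)
    with deriv show "\<exists>D. (\<psi> has_real_derivative D) (at v) \<and> D \<le> 0" by blast
  qed simp
  then show ?thesis by (simp add: \<psi>_def d_def)
qed

text \<open>Stands in for the subdifferential sum rule. Comparing \<open>p\<close> with a point at
  fraction \<open>v\<close> of the way to \<open>z\<close> and dividing by \<open>v\<close> leaves
  an error \<open>v * K\<close>, which vanishes as \<open>v\<close> tends to 0 from the right. Only
  the slope \<open>D\<close> survives.\<close>

lemma econvex_quadratic_minimizer:
  fixes f :: "'a::real_vector \<Rightarrow> ereal" and q :: "'a \<Rightarrow> real"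
  assumes convex: "econvex f"
    and min: "is_arg_min (\<lambda>z. f z + ereal (q z)) (\<lambda>_. True) p"
    and fin: "f p = ereal a" "f z = ereal c"
    and quadratic: "\<And>v. q (p + v *\<^sub>R (z - p)) = q p + v * D + v\<^sup>2 * K"
  shows "a \<le> c + D"
proof -
  have step: "0 \<le> c - a + D + v * K" if "0 < v" "v \<le> 1" for v
  proof -
    define y where "y = p + v *\<^sub>R (z - p)"
    have "y = (1 - v) *\<^sub>R p + v *\<^sub>R z" by (simp add: y_def algebra_simps)
    then have "f y \<le> ereal (1 - v) * f p + ereal v * f z"
      using convex that unfolding econvex_def by auto
    then have "f y \<le> ereal ((1 - v) * a + v * c)" by (simp add: fin)
    moreover have "f p + ereal (q p) \<le> f y + ereal (q y)"
      using min by (auto simp: is_arg_min_def not_less)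
    ultimately have "ereal (a + q p) \<le> ereal ((1 - v) * a + v * c) + ereal (q y)"
      using fin(1) by (metis add_right_mono order_trans plus_ereal.simps(1))
    moreover have "q y = q p + v * D + v\<^sup>2 * K" unfolding y_def by (rule quadratic)
    ultimately have "0 \<le> v * (c - a + D + v * K)"
      by (simp add: algebra_simps power2_eq_square)
    with that show ?thesis by (simp add: zero_le_mult_iff)
  qed
  have "((\<lambda>v. c - a + D + v * K) \<longlongrightarrow> c - a + D + 0 * K) (at_right 0)"
    by (intro tendsto_intros)
  moreover have "\<forall>\<^sub>F v in at_right 0. 0 \<le> c - a + D + v * K"
    unfolding eventually_at_right_field by (intro exI[of _ 1]) (auto intro: step)
  ultimately have "0 \<le> c - a + D + 0 * K"
    by (rule tendsto_lowerbound) simp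
  then show ?thesis by simp
qed

lemma norm_sq_add_scaleR:
  fixes p d :: "'a::real_inner"
  shows "(norm (p + v *\<^sub>R d))\<^sup>2 = (norm p)\<^sup>2 + v * (2 * (p \<bullet> d)) + v\<^sup>2 * (norm d)\<^sup>2"
  unfolding power2_norm_eq_inner
  by (simp add: inner_add_left inner_add_right inner_commute power2_eq_square algebra_simps)

text \<open>At the minimizer the linear term and the gradient of the penalty combine into the new
  multiplier: the vector inside the penalty, times \<open>s\<close>, is the residual of the
  extrapolated point that drives the dual update.\<close>

lemma primal_step_inequality:
  fixes A :: "real^'m^'p"
  assumes convex: "econvex f1"
    and min: "is_arg_min (primal_objective f1 g A b \<alpha> \<gamma> s y w l) (\<lambda>_. True) p"
    and fin: "f1 p = ereal a" "f1 z = ereal c"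
    and s: "s \<noteq> 0"
    and lp: "lp = l + (\<gamma> * s) *\<^sub>R (A *v (p + (s - 1) *\<^sub>R (p - y)) - b)"
  shows "a \<le> c + lp \<bullet> (A *v (z - p)) + g \<bullet> (z - p) + 1 / \<alpha> * ((p - w) \<bullet> (z - p))"
proof -
  define e where "e = A *v (p - y) + (1 / s) *\<^sub>R (A *v y - b)"
  define q where "q v = (transpose A *v l + g) \<bullet> v
       + \<gamma> * s\<^sup>2 / 2 * (norm (A *v (v - y) + (1 / s) *\<^sub>R (A *v y - b)))\<^sup>2
       + 1 / (2 * \<alpha>) * (norm (v - w))\<^sup>2" for v
  define D where "D = (transpose A *v l + g) \<bullet> (z - p)
       + \<gamma> * s\<^sup>2 * (e \<bullet> (A *v (z - p))) + 1 / \<alpha> * ((p - w) \<bullet> (z - p))"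
  \<comment> \<open>\<open>D\<close> is the directional derivative of \<open>q\<close> at
    \<open>p\<close> towards \<open>z\<close>, and \<open>K\<close> is its second-order
    coefficient.\<close>
  define K where "K = \<gamma> * s\<^sup>2 / 2 * (norm (A *v (z - p)))\<^sup>2 + 1 / (2 * \<alpha>) * (norm (z - p))\<^sup>2"
  have expand: "q (p + v *\<^sub>R (z - p)) = q p + v * D + v\<^sup>2 * K" for v
  proof -
    have 1: "A *v (p + v *\<^sub>R (z - p) - y) + (1 / s) *\<^sub>R (A *v y - b) = e + v *\<^sub>R (A *v (z - p))"
      by (simp add: e_def matrix_vector_mult_diff_distrib matrix_vector_right_distrib
          matrix_vector_mult_scaleR algebra_simps)
    have 2: "p + v *\<^sub>R (z - p) - w = (p - w) + v *\<^sub>R (z - p)" by simp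
    show ?thesis
      unfolding q_def 1 2 norm_sq_add_scaleR D_def K_def inner_add_right inner_scaleR_right
        e_def[symmetric]
      by (simp add: algebra_simps add_divide_distrib)
  qed
  have "a \<le> c + D"
    by (rule econvex_quadratic_minimizer[OF convex _ fin expand])
      (use min in \<open>simp add: primal_objective_def[abs_def] q_def[abs_def]\<close>)
  moreover have "A *v (p + (s - 1) *\<^sub>R (p - y)) - b = s *\<^sub>R e"
    using s by (simp add: e_def matrix_vector_mult_diff_distrib matrix_vector_right_distrib
        matrix_vector_mult_scaleR algebra_simps)
  then have "lp \<bullet> (A *v (z - p)) = l \<bullet> (A *v (z - p)) + \<gamma> * s\<^sup>2 * (e \<bullet> (A *v (z - p)))"
    by (simp add: lp inner_add_left power2_eq_square)
  moreover have "(transpose A *v l) \<bullet> (z - p) = l \<bullet> (A *v (z - p))"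
    by (simp add: dot_lmul_matrix)
  ultimately show ?thesis by (simp add: D_def inner_add_left)
qed

text \<open>\<open>un\<close> and \<open>up\<close> stand for the old and new extrapolated points,
  \<open>r\<close> and \<open>rp\<close> for the constraint residuals. With weights
  \<open>s\<^sup>2 - s\<close> and \<open>s\<close>, the two inequalities produce inner products
  that three-point identities turn into differences of squared distances, primal and dual.\<close>

lemma energy_step:
  fixes x p xs w up un :: "'a::real_inner" and r rp l lp ls :: "'b::real_inner"
  assumes s: "s \<ge> 1" and pos: "\<alpha> > 0" "\<gamma> > 0"
    and at_x: "Fp \<le> F + lp \<bullet> (r - rp) + 1 / \<alpha> * ((p - w) \<bullet> (x - p)) + 1 / (2 * \<alpha>) * (norm (p - w))\<^sup>2"
    and at_xs: "Fp \<le> Fs + lp \<bullet> (- rp) + 1 / \<alpha> * ((p - w) \<bullet> (xs - p)) + 1 / (2 * \<alpha>) * (norm (p - w))\<^sup>2"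
    and up: "up = p + (s - 1) *\<^sub>R (p - x)"
    and un: "s *\<^sub>R (p - w) = up - un"
    and lp: "lp = l + (\<gamma> * s) *\<^sub>R (s *\<^sub>R rp - (s - 1) *\<^sub>R r)"
  shows "s\<^sup>2 * (Fp - Fs + ls \<bullet> rp) + 1 / (2 * \<alpha>) * (norm (up - xs))\<^sup>2 + 1 / (2 * \<gamma>) * (norm (lp - ls))\<^sup>2
    \<le> (s\<^sup>2 - s) * (F - Fs + ls \<bullet> r) + 1 / (2 * \<alpha>) * (norm (un - xs))\<^sup>2 + 1 / (2 * \<gamma>) * (norm (l - ls))\<^sup>2"
proof -
  define e where "e = s *\<^sub>R rp - (s - 1) *\<^sub>R r"
  have weights: "0 \<le> s\<^sup>2 - s" "0 \<le> s" using s by (auto simp: power2_eq_square)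
  have combined: "s\<^sup>2 * Fp \<le> (s\<^sup>2 - s) * F + s * Fs - s * (lp \<bullet> e)
      + 1 / \<alpha> * (s * ((p - w) \<bullet> ((s - 1) *\<^sub>R (x - p) + (xs - p)))) + 1 / (2 * \<alpha>) * (s\<^sup>2 * (norm (p - w))\<^sup>2)"
  proof -
    \<comment> \<open>Naming the quotients and inner products keeps them atomic, so the weighted sum
      is a polynomial identity check.\<close>
    define c c' n ix ixs where "c = 1 / \<alpha>" and "c' = 1 / (2 * \<alpha>)" and "n = (norm (p - w))\<^sup>2"
      and "ix = (p - w) \<bullet> (x - p)" and "ixs = (p - w) \<bullet> (xs - p)"
    note folds = this
    show ?thesis
      using add_mono[OF mult_left_mono[OF at_x weights(1)] mult_left_mono[OF at_xs weights(2)]]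
      unfolding e_def inner_add_right inner_diff_right[of lp] inner_minus_right
        inner_scaleR_right folds[symmetric]
      by (simp add: power2_eq_square algebra_simps)
  qed
  have "(s - 1) *\<^sub>R (x - p) + (xs - p) = xs - up" by (simp add: up algebra_simps)
  then have 1: "s * ((p - w) \<bullet> ((s - 1) *\<^sub>R (x - p) + (xs - p))) = (up - un) \<bullet> (xs - up)"
    unfolding un[symmetric] by (simp only: inner_scaleR_left)
  have 2: "s\<^sup>2 * (norm (p - w))\<^sup>2 = (norm (up - un))\<^sup>2"
    by (simp add: power_mult_distrib flip: un)
  have "2 * ((up - un) \<bullet> (xs - up)) + (norm (up - un))\<^sup>2 = (norm (un - xs))\<^sup>2 - (norm (up - xs))\<^sup>2"
    by (simp add: power2_norm_eq_inner inner_diff_left inner_diff_right inner_commute algebra_simps)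
  then have primal: "1 / \<alpha> * ((up - un) \<bullet> (xs - up)) + 1 / (2 * \<alpha>) * (norm (up - un))\<^sup>2
      = 1 / (2 * \<alpha>) * (norm (un - xs))\<^sup>2 - 1 / (2 * \<alpha>) * (norm (up - xs))\<^sup>2"
    using pos by (simp add: field_simps)
  have diff: "lp - l = (\<gamma> * s) *\<^sub>R e" by (simp add: lp e_def)
  \<comment> \<open>Dual three-point identity; the square of \<open>lp - l\<close> is then
    discarded, which is why only an inequality follows.\<close>
  have "2 * ((lp - ls) \<bullet> (lp - l)) = (norm (lp - ls))\<^sup>2 + (norm (lp - l))\<^sup>2 - (norm (l - ls))\<^sup>2"
    by (simp add: power2_norm_eq_inner inner_diff_left inner_diff_right inner_commute algebra_simps)
  then have "2 * \<gamma> * (s * ((lp - ls) \<bullet> e)) \<ge> (norm (lp - ls))\<^sup>2 - (norm (l - ls))\<^sup>2"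
    unfolding diff by (simp add: algebra_simps)
  then have dual: "1 / (2 * \<gamma>) * (norm (lp - ls))\<^sup>2 - 1 / (2 * \<gamma>) * (norm (l - ls))\<^sup>2 \<le> s * ((lp - ls) \<bullet> e)"
    using pos by (simp add: field_simps)
  have "s * (ls \<bullet> e) = s\<^sup>2 * (ls \<bullet> rp) - (s\<^sup>2 - s) * (ls \<bullet> r)"
    by (simp add: e_def inner_diff_right power2_eq_square algebra_simps)
  with combined primal dual show ?thesis
    unfolding 1 2 by (simp add: inner_diff_left algebra_simps)
qed

text \<open>The recursion makes \<open>P (k + 1) - h (k + 1)\<close> a convex combination of
  \<open>P k\<close> and \<open>P k - h k\<close>, so \<open>C\<close> bounds the difference for all
  \<open>k\<close>. Recovering \<open>h k\<close> from \<open>P k\<close> and this difference costs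
  the factor 2.\<close>

lemma bounded_recursion:
  fixes h P :: "nat \<Rightarrow> 'a::real_normed_vector"
  assumes start: "P 1 = h 1" and C: "0 \<le> C"
    and P: "\<And>k. k \<ge> 1 \<Longrightarrow> norm (P k) \<le> C"
    and w: "\<And>k. k \<ge> 1 \<Longrightarrow> 0 \<le> w k \<and> w k \<le> 1"
    and rec: "\<And>k. k \<ge> 1 \<Longrightarrow> P (k + 1) - P k = h (k + 1) - w k *\<^sub>R h k"
    and k: "k \<ge> 1"
  shows "norm (h k) \<le> 2 * C"
proof -
  have "norm (P k - h k) \<le> C"
    using k
  proof (induction k rule: dec_induct)
    case base
    then show ?case using start C by simp
  next
    case (step k)
    have "P (Suc k) - h (Suc k) = (1 - w k) *\<^sub>R P k + w k *\<^sub>R (P k - h k)"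
      using rec[of k] step.hyps by (simp add: algebra_simps)
    then have "norm (P (Suc k) - h (Suc k)) \<le> (1 - w k) * norm (P k) + w k * norm (P k - h k)"
      using w[of k] step.hyps norm_triangle_ineq[of "(1 - w k) *\<^sub>R P k" "w k *\<^sub>R (P k - h k)"]
      by simp
    also have "\<dots> \<le> (1 - w k) * C + w k * C"
      using w[of k] P[of k] step by (intro add_mono mult_left_mono) auto
    finally show ?case by (simp add: algebra_simps)
  qed
  with P[OF k] show ?thesis
    using norm_triangle_ineq4[of "P k" "P k - h k"] by simp
qed

text \<open>Moving the multiplier by the residual itself would raise the Lagrangian by the squared
  norm of the residual.\<close>

lemma saddle_point_feasible:
  assumes "(xs, ls) \<in> saddle_points f A b" and "\<bar>f xs\<bar> \<noteq> \<infinity>"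
  shows "A *v xs = b"
proof -
  obtain c where c: "f xs = ereal c" using assms(2) by auto
  have "lagrangian f A b xs (ls + (A *v xs - b)) \<le> lagrangian f A b xs ls"
    using assms(1) unfolding saddle_points_def by blast
  then have "(A *v xs - b) \<bullet> (A *v xs - b) \<le> 0"
    by (simp add: lagrangian_def c inner_add_left)
  then have "(A *v xs - b) \<bullet> (A *v xs - b) = 0"
    using inner_ge_zero by (rule order_antisym)
  then show ?thesis by simp
qed

theorem theorem3:
  fixes f1 f :: "real^'m \<Rightarrow> ereal"
    and f2 :: "real^'m \<Rightarrow> real"
    and gf2 :: "real^'m \<Rightarrow> real^'m"
    and A :: "real^'m^'p" and b :: "real^'p"
    and L \<alpha> \<gamma> :: real
    and t :: "nat \<Rightarrow> real"
    and x xbar u :: "nat \<Rightarrow> real^'m"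
    and lam :: "nat \<Rightarrow> real^'p"
    and xs :: "real^'m" and ls :: "real^'p"
    and E1 C3 :: real
  assumes f1_range: "\<And>z. f1 z \<noteq> -\<infinity>"
    and f1_proper: "eproper f1"
    and f1_closed: "eclosed f1"
    and f1_convex: "econvex f1"
    and f2_convex: "convex_on UNIV f2"
    and f2_gradient: "\<And>z. GDERIV f2 z :> gf2 z"
    and gf2_lipschitz: "L-lipschitz_on UNIV gf2"
    and f_eq: "f = (\<lambda>z. f1 z + ereal (f2 z))"
    and alpha_pos: "\<alpha> > 0"
    and gamma_pos: "\<gamma> > 0"
    and saddle: "(xs, ls) \<in> saddle_points f A b"
    and iterates: "accelerated_alm_iterates f1 gf2 A b \<alpha> \<gamma> t x xbar u lam"
    and alpha_le: "ereal \<alpha> \<le> 1 / ereal L"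
    and t_ge_1: "\<And>k. k \<ge> 1 \<Longrightarrow> t k \<ge> 1"
    and t_mono: "\<And>k. k \<ge> 1 \<Longrightarrow> t k \<le> t (k + 1)"
    and t_growth: "\<And>k. k \<ge> 1 \<Longrightarrow> (t (k + 1))\<^sup>2 \<le> (t k)\<^sup>2 + t (k + 1)"
    and E1_eq: "E1 = initial_energy f A b \<alpha> \<gamma> (t 1) (x 1) (lam 1) xs ls"
    and C3_eq: "C3 = feasibility_const f A b \<alpha> \<gamma> (t 1) (x 1) (lam 1) xs ls"
  shows "\<forall>k\<ge>1. norm (A *v x k - b) \<le> C3 / (t k)\<^sup>2 \<and>
           \<bar>f (x k) - f xs\<bar> \<le> ereal ((E1 + C3 * norm ls) / (t k)\<^sup>2)"
proof -

  \<comment> \<open>Step-size bound, finiteness along the iterates, and feasibility of the saddle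
    point\<close>
  have L: "0 \<le> L" using gf2_lipschitz by (rule lipschitz_on_nonneg)
  have L_le: "L \<le> 1 / \<alpha>"
  \<comment> \<open>For \<open>L = 0\<close> the quotient \<open>1 / ereal L\<close> is infinite and
    the assumption on \<alpha> says nothing; the claim is then just positivity of
    \<open>1 / \<alpha>\<close>.\<close>
  proof (cases "L = 0")
    case False
    then have "\<alpha> \<le> 1 / L" using alpha_le by (simp add: one_ereal_def)
    with False L alpha_pos show ?thesis by (simp add: field_simps)
  qed (use alpha_pos in simp)
  have x_init: "x 1 = x 0" "x 0 \<in> edom f1"
    using iterates by (auto simp: accelerated_alm_iterates_def)
  have step:
    "xbar k = x k + ((t k - 1) / t (k + 1)) *\<^sub>R (x k - x (k - 1))"
    "is_arg_min (primal_objective f1 (gf2 (xbar k)) A b \<alpha> \<gamma> (t (k + 1)) (x k) (xbar k) (lam k))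
          (\<lambda>_. True) (x (k + 1))"
    "u (k + 1) = x (k + 1) + (t (k + 1) - 1) *\<^sub>R (x (k + 1) - x k)"
    "lam (k + 1) = lam k + (\<gamma> * t (k + 1)) *\<^sub>R (A *v u (k + 1) - b)"
    if "k \<ge> 1" for k
    using iterates that by (auto simp: accelerated_alm_iterates_def)
  define F1 where "F1 z = real_of_ereal (f1 z)" for z
  define F where "F z = F1 z + f2 z" for z
  have F1: "f1 z = ereal (F1 z)" if "f1 z < \<infinity>" for z
    using that f1_range[of z] by (cases "f1 z") (auto simp: F1_def)
  have F: "f z = ereal (F z)" if "f1 z < \<infinity>" for z
    using F1[OF that] by (simp add: f_eq F_def)
  have x_dom: "f1 (x k) < \<infinity>" if "k \<ge> 1" for k
    using that
  proof (induction k rule: dec_induct)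
    case base
    then show ?case using x_init by (simp add: edom_def)
  next
    case (step k)
    let ?obj = "primal_objective f1 (gf2 (xbar k)) A b \<alpha> \<gamma> (t (k + 1)) (x k) (xbar k) (lam k)"
    \<comment> \<open>The starting point serves as a finite competitor in every step.\<close>
    have "?obj (x (k + 1)) \<le> ?obj (x 0)"
      using \<open>k \<ge> 1\<close> step(2) iterates
      by (auto simp: accelerated_alm_iterates_def is_arg_min_def not_less)
    also have "\<dots> < \<infinity>"
      using x_init(2) by (simp add: primal_objective_def edom_def)
    finally show ?case by (simp add: primal_objective_def)
  qed
  have lagrangian_min: "lagrangian f A b xs ls \<le> lagrangian f A b z ls" for z
    using saddle unfolding saddle_points_def by blast
  note lagrangian_min[of "x 1"]
  also have "lagrangian f A b (x 1) ls < \<infinity>"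
    using F[OF x_dom[of 1]] by (simp add: lagrangian_def)
  finally have xs_dom: "f1 xs < \<infinity>" by (simp add: lagrangian_def f_eq)
  have feasible: "A *v xs = b"
    by (rule saddle_point_feasible[OF saddle]) (simp add: F[OF xs_dom])

  \<comment> \<open>Monotonicity of the energy and boundedness of the multipliers\<close>
  define r where "r k = A *v x k - b" for k
  define gap where "gap k = F (x k) - F xs + ls \<bullet> r k" for k
  have gap_nonneg: "0 \<le> gap k" if "k \<ge> 1" for k
    using lagrangian_min[of "x k"] F[OF xs_dom] F[OF x_dom[OF that]]
    by (simp add: lagrangian_def feasible gap_def r_def)
  \<comment> \<open>The given \<open>u 1\<close> is arbitrary; this formula gives \<open>U 1 = x 1\<close>.\<close>
  define U where "U k = x k + (t k - 1) *\<^sub>R (x k - x (k - 1))" for k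
  define E where "E k = (t k)\<^sup>2 * gap k + 1 / (2 * \<alpha>) * (norm (U k - xs))\<^sup>2
    + 1 / (2 * \<gamma>) * (norm (lam k - ls))\<^sup>2" for k
  have residual: "A *v u (k + 1) - b = t (k + 1) *\<^sub>R r (k + 1) - (t (k + 1) - 1) *\<^sub>R r k"
    if "k \<ge> 1" for k
    unfolding step(3)[OF that] r_def
    by (simp add: matrix_vector_mult_diff_distrib matrix_vector_right_distrib
        matrix_vector_mult_scaleR algebra_simps)
  \<comment> \<open>The smooth part is linearised at \<open>xbar k\<close>: convexity bounds it from
    below at \<open>z\<close>, the descent lemma from above at the new iterate. The bound on
    \<alpha> replaces \<open>L / 2\<close> by \<open>1 / (2 * \<alpha>)\<close>.\<close>
  have key: "F (x (k + 1)) \<le> F z + lam (k + 1) \<bullet> (A *v (z - x (k + 1)))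
      + 1 / \<alpha> * ((x (k + 1) - xbar k) \<bullet> (z - x (k + 1)))
      + 1 / (2 * \<alpha>) * (norm (x (k + 1) - xbar k))\<^sup>2"
    if k: "k \<ge> 1" and z: "f1 z < \<infinity>" for k z
  proof -
    let ?p = "x (k + 1)" and ?w = "xbar k"
    have p_dom: "f1 ?p < \<infinity>" and s: "t (k + 1) \<noteq> 0"
      using x_dom[of "k + 1"] t_ge_1[of "k + 1"] by auto
    have "F1 ?p \<le> F1 z + lam (k + 1) \<bullet> (A *v (z - ?p)) + gf2 ?w \<bullet> (z - ?p)
        + 1 / \<alpha> * ((?p - ?w) \<bullet> (z - ?p))"
      by (rule primal_step_inequality[OF f1_convex step(2)[OF k] F1[OF p_dom] F1[OF z] s])
        (use step(4)[OF k] in \<open>unfold step(3)[OF k]\<close>)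
    moreover have "f2 ?w + gf2 ?w \<bullet> (z - ?w) \<le> f2 z"
      by (rule convex_on_gradient_inequality[OF f2_convex f2_gradient])
    moreover have "f2 ?p \<le> f2 ?w + gf2 ?w \<bullet> (?p - ?w) + L / 2 * (norm (?p - ?w))\<^sup>2"
      by (rule descent_lemma[OF f2_gradient gf2_lipschitz])
    moreover have "L / 2 * (norm (?p - ?w))\<^sup>2 \<le> 1 / (2 * \<alpha>) * (norm (?p - ?w))\<^sup>2"
      using L_le by (intro mult_right_mono) (auto simp: field_simps)
    ultimately show ?thesis by (simp add: F_def inner_diff_right)
  qed
  have decrease: "E (k + 1) \<le> E k" if k: "k \<ge> 1" for k
  proof -
    let ?s = "t (k + 1)"
    have s: "?s \<ge> 1" using t_ge_1[of "k + 1"] by simp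
    \<comment> \<open>The denominator in the extrapolation is chosen so that scaling
      \<open>x (k + 1) - xbar k\<close> by \<open>t (k + 1)\<close> gives exactly
      \<open>U (k + 1) - U k\<close>.\<close>
    then have cancel: "?s * ((t k - 1) / ?s) = t k - 1" by simp
    have "?s\<^sup>2 * (F (x (k + 1)) - F xs + ls \<bullet> r (k + 1)) + 1 / (2 * \<alpha>) * (norm (U (k + 1) - xs))\<^sup>2
        + 1 / (2 * \<gamma>) * (norm (lam (k + 1) - ls))\<^sup>2
      \<le> (?s\<^sup>2 - ?s) * (F (x k) - F xs + ls \<bullet> r k) + 1 / (2 * \<alpha>) * (norm (U k - xs))\<^sup>2
        + 1 / (2 * \<gamma>) * (norm (lam k - ls))\<^sup>2"
    proof (rule energy_step[OF s alpha_pos gamma_pos])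
      show "F (x (k + 1)) \<le> F (x k) + lam (k + 1) \<bullet> (r k - r (k + 1))
          + 1 / \<alpha> * ((x (k + 1) - xbar k) \<bullet> (x k - x (k + 1)))
          + 1 / (2 * \<alpha>) * (norm (x (k + 1) - xbar k))\<^sup>2"
        using key[OF k x_dom[OF k]] by (simp add: r_def matrix_vector_mult_diff_distrib)
      show "F (x (k + 1)) \<le> F xs + lam (k + 1) \<bullet> (- r (k + 1))
          + 1 / \<alpha> * ((x (k + 1) - xbar k) \<bullet> (xs - x (k + 1)))
          + 1 / (2 * \<alpha>) * (norm (x (k + 1) - xbar k))\<^sup>2"
        using key[OF k xs_dom] by (simp add: r_def matrix_vector_mult_diff_distrib feasible)
      show "U (k + 1) = x (k + 1) + (?s - 1) *\<^sub>R (x (k + 1) - x k)" by (simp add: U_def)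
      show "?s *\<^sub>R (x (k + 1) - xbar k) = U (k + 1) - U k"
        unfolding step(1)[OF k] U_def scaleR_diff_right[of ?s] scaleR_add_right[of ?s] scaleR_scaleR
          cancel
        by (simp add: algebra_simps)
      show "lam (k + 1) = lam k + (\<gamma> * ?s) *\<^sub>R (?s *\<^sub>R r (k + 1) - (?s - 1) *\<^sub>R r k)"
        using step(4)[OF k] residual[OF k] by simp
    qed
    \<comment> \<open>The growth condition on \<open>t\<close> enters here; it can be multiplied by
      the gap because the saddle point makes the gap nonnegative.\<close>
    moreover have "(?s\<^sup>2 - ?s) * gap k \<le> (t k)\<^sup>2 * gap k"
      using t_growth[OF k] gap_nonneg[OF k] by (intro mult_right_mono) auto
    ultimately show ?thesis by (simp add: E_def gap_def)
  qed
  have E1: "E 1 = E1"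
    using x_init(1) F[OF xs_dom] F[OF x_dom[of 1]]
    by (simp add: E1_eq initial_energy_def E_def gap_def U_def r_def)
  have E_le: "E k \<le> E1" if "k \<ge> 1" for k
    using that
  proof (induction k rule: dec_induct)
    case (step k)
    then show ?case using decrease[of k] by simp
  qed (simp add: E1[simplified])
  have gap_le: "(t k)\<^sup>2 * gap k \<le> E1" if "k \<ge> 1" for k
  proof -
    have "(t k)\<^sup>2 * gap k \<le> E k" using alpha_pos gamma_pos by (simp add: E_def)
    with E_le[OF that] show ?thesis by simp
  qed
  have lam_le: "norm (lam k - ls) \<le> sqrt (2 * \<gamma> * E1)" if "k \<ge> 1" for k
  proof (rule real_le_rsqrt)
    have "0 \<le> (t k)\<^sup>2 * gap k" using gap_nonneg[OF that] by simp
    then have "1 / (2 * \<gamma>) * (norm (lam k - ls))\<^sup>2 \<le> E k" using alpha_pos by (simp add: E_def)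
    also note E_le[OF that]
    finally show "(norm (lam k - ls))\<^sup>2 \<le> 2 * \<gamma> * E1" using gamma_pos by (simp add: field_simps)
  qed

  \<comment> \<open>Feasibility bound from the recursion for the scaled residuals\<close>
  define h where "h k = (t k)\<^sup>2 *\<^sub>R r k" for k
  \<comment> \<open>The dual update divided by \<gamma> gives the increments of \<open>P\<close>;
    the shift by \<open>h 1\<close> provides the starting value \<open>P 1 = h 1\<close>.\<close>
  define P where "P k = (1 / \<gamma>) *\<^sub>R (lam k - lam 1) + h 1" for k
  \<comment> \<open>Triangle inequality through \<open>ls\<close>: the first multiplier keeps its
    own distance, the later one is bounded by the energy.\<close>
  define C where "C = norm (h 1) + (norm (lam 1 - ls) + sqrt (2 * \<gamma> * E1)) / \<gamma>"
  have E1_nonneg: "0 \<le> E1"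
    using gap_nonneg[of 1] gap_le[of 1] by (smt (verit) zero_le_mult_iff zero_le_power2 order_refl)
  have "0 \<le> C" using E1_nonneg gamma_pos by (simp add: C_def)
  have P_le: "norm (P k) \<le> C" if "k \<ge> 1" for k
  proof -
    have "norm (lam k - lam 1) \<le> norm (lam 1 - ls) + sqrt (2 * \<gamma> * E1)"
      using lam_le[OF that] norm_triangle_ineq4[of "lam k - ls" "lam 1 - ls"] by simp
    then have "norm ((1 / \<gamma>) *\<^sub>R (lam k - lam 1)) \<le> (norm (lam 1 - ls) + sqrt (2 * \<gamma> * E1)) / \<gamma>"
      using gamma_pos by (simp add: divide_right_mono)
    then show ?thesis
      unfolding P_def C_def by (intro norm_triangle_le) simp
  qed
  define w where "w k = ((t (k + 1))\<^sup>2 - t (k + 1)) / (t k)\<^sup>2" for k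
  have w: "0 \<le> w k \<and> w k \<le> 1" if "k \<ge> 1" for k
    using t_ge_1[OF that] t_ge_1[of "k + 1"] t_growth[OF that]
    by (simp add: w_def power2_eq_square)
  have rec: "P (k + 1) - P k = h (k + 1) - w k *\<^sub>R h k" if "k \<ge> 1" for k
  proof -
    have "P (k + 1) - P k = (1 / \<gamma>) *\<^sub>R (lam (k + 1) - lam k)"
      by (simp add: P_def algebra_simps)
    also have "\<dots> = t (k + 1) *\<^sub>R (t (k + 1) *\<^sub>R r (k + 1) - (t (k + 1) - 1) *\<^sub>R r k)"
      unfolding step(4)[OF that] residual[OF that] using gamma_pos by simp
    also have "\<dots> = h (k + 1) - ((t (k + 1))\<^sup>2 - t (k + 1)) *\<^sub>R r k"
      by (simp add: h_def power2_eq_square algebra_simps)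
    also have "((t (k + 1))\<^sup>2 - t (k + 1)) *\<^sub>R r k = w k *\<^sub>R h k"
      using t_ge_1[OF that] by (simp add: w_def h_def)
    finally show ?thesis .
  qed
  have h_le: "norm (h k) \<le> C3" if "k \<ge> 1" for k
  proof -
    have "norm (h k) \<le> 2 * C"
      by (rule bounded_recursion[where P = P and h = h and w = w, OF _ \<open>0 \<le> C\<close> P_le w rec that]) (simp add: P_def)
    \<comment> \<open>Doubling \<open>C\<close> yields the coefficient 2 on the initial residual,
      which the 3 in the stated constant dominates.\<close>
    also have "\<dots> \<le> C3"
      unfolding C3_eq feasibility_const_def E1_eq[symmetric]
      by (simp add: C_def h_def r_def add_divide_distrib)
    finally show ?thesis .
  qed

  \<comment> \<open>The two convergence rates\<close>
  show ?thesis
  proof (intro allI impI conjI)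
    fix k :: nat assume k: "k \<ge> 1"
    have tk: "0 < (t k)\<^sup>2" using t_ge_1[OF k] by simp
    have r_le: "norm (r k) \<le> C3 / (t k)\<^sup>2"
      using h_le[OF k] tk by (simp add: h_def field_simps)
    then show "norm (A *v x k - b) \<le> C3 / (t k)\<^sup>2" by (simp add: r_def)
    have "\<bar>ls \<bullet> r k\<bar> \<le> norm ls * norm (r k)" by (rule Cauchy_Schwarz_ineq2)
    also have "\<dots> \<le> norm ls * (C3 / (t k)\<^sup>2)" using r_le by (rule mult_left_mono) simp
    finally have "\<bar>ls \<bullet> r k\<bar> \<le> C3 * norm ls / (t k)\<^sup>2" by (simp add: mult.commute)
    moreover have "gap k \<le> E1 / (t k)\<^sup>2"
      using gap_le[OF k] tk by (simp add: field_simps)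
    \<comment> \<open>The objective difference is the gap minus \<open>ls \<bullet> r k\<close>. The
      upper estimate uses the upper bound on the gap, the lower one its nonnegativity.\<close>
    ultimately have "\<bar>F (x k) - F xs\<bar> \<le> (E1 + C3 * norm ls) / (t k)\<^sup>2"
      using gap_nonneg[OF k] by (simp add: gap_def add_divide_distrib abs_le_iff)
    then show "\<bar>f (x k) - f xs\<bar> \<le> ereal ((E1 + C3 * norm ls) / (t k)\<^sup>2)"
      by (simp add: F[OF xs_dom] F[OF x_dom[OF k]])
  qed
qed

end
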